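(* Let $m\geqslant 2$, let $Y,C_1,\ldots,C_{m-1}$ be independent absolutely continuous nonnegative random variables, and define $$Z=\max\{Y,C_1,\ldots,C_{m-1}\},\qquad \delta=\mathbf 1_{\{Y\geqslant C_j,\ j=1,\ldots,m-1\}}.$$ Assume that for each $j=1,\ldots,m-1$ there is a constant $\beta_j>0$ such that $$r_{C_j}(t)=\beta_j r_Y(t),\qquad t\geqslant 0,$$ where $r$ denotes the reversed hazard rate. Then $Z$ and $\delta$ are independent.
   Context: For an absolutely continuous nonnegative random variable $X$ with density $f_X$ and distribution function $F_X(t)=\mathbb P(X\leqslant t)$, the reversed hazard rate is $r_X(t)=f_X(t)/F_X(t)$, defined where $F_X(t)>0$. Since densities are determined only almost everywhere, the proportionality $r_{C_j}(t)=\beta_jr_Y(t)$ is understood for Lebesgue-almost every $t\geqslant 0$ at which both reversed hazard rates are defined. $\mathbf 1$ denotes an indicator. *)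

theory Defs
  imports "HOL-Probability.Probability"
begin

text \<open>
  Absolute continuity is expressed by a real-valued density, determined only up to a null set.
  Pointwise nonnegativity of \<open>f\<close> is needed because \<open>ennreal\<close> truncates negative values, so that
  otherwise \<open>f\<close> could differ from the actual density wherever it is negative.
\<close>

definition nonneg_rv_with_density :: "'a measure \<Rightarrow> ('a \<Rightarrow> real) \<Rightarrow> (real \<Rightarrow> real) \<Rightarrow> bool" where
  "nonneg_rv_with_density M X f \<longleftrightarrow>
     (\<forall>t. 0 \<le> f t) \<and>
     distributed M lborel X (\<lambda>t. ennreal (f t)) \<and>
     (AE \<omega> in M. 0 \<le> X \<omega>)"

definition dist_fun :: "'a measure \<Rightarrow> ('a \<Rightarrow> real) \<Rightarrow> real \<Rightarrow> real" where
  "dist_fun M X = cdf (distr M borel X)"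

text \<open>
  Only meaningful where \<open>dist_fun M X t > 0\<close>; elsewhere division by zero returns \<open>0\<close>.
\<close>

definition reversed_hazard_rate ::
  "'a measure \<Rightarrow> ('a \<Rightarrow> real) \<Rightarrow> (real \<Rightarrow> real) \<Rightarrow> real \<Rightarrow> real" where
  "reversed_hazard_rate M X f t = f t / dist_fun M X t"

definition proportional_reversed_hazards ::
  "'a measure \<Rightarrow> real \<Rightarrow> ('a \<Rightarrow> real) \<Rightarrow> (real \<Rightarrow> real) \<Rightarrow> ('a \<Rightarrow> real) \<Rightarrow> (real \<Rightarrow> real) \<Rightarrow> bool" where
  "proportional_reversed_hazards M \<beta> C g Y f \<longleftrightarrow>
     (AE t in lborel. 0 \<le> t \<longrightarrow> 0 < dist_fun M C t \<longrightarrow> 0 < dist_fun M Y t \<longrightarrow>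
        reversed_hazard_rate M C g t = \<beta> * reversed_hazard_rate M Y f t)"

definition observed_max :: "nat \<Rightarrow> ('a \<Rightarrow> real) \<Rightarrow> (nat \<Rightarrow> 'a \<Rightarrow> real) \<Rightarrow> 'a \<Rightarrow> real" where
  "observed_max m Y C \<omega> = Max (insert (Y \<omega>) ((\<lambda>j. C j \<omega>) ` {1..m - 1}))"

definition max_indicator :: "nat \<Rightarrow> ('a \<Rightarrow> real) \<Rightarrow> (nat \<Rightarrow> 'a \<Rightarrow> real) \<Rightarrow> 'a \<Rightarrow> real" where
  "max_indicator m Y C = indicator {\<omega>. \<forall>j\<in>{1..m - 1}. Y \<omega> \<ge> C j \<omega>}"

end

theory Submission
  imports Defs
begin

text \<open>
  Write \<open>X\<^sub>0 = Y\<close>, \<open>X\<^sub>i = C\<^sub>i\<close>, with densities \<open>f\<^sub>i\<close> and distribution functions \<open>F\<^sub>i\<close>. By independence, the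
  event that \<open>Z \<in> A\<close> and that \<open>X\<^sub>i\<close> is the largest of the variables has probability
  \<open>\<integral>\<^sub>A f\<^sub>i \<Prod>\<^sub>k\<^sub>\<noteq>\<^sub>i F\<^sub>k\<close>. Since \<open>f\<^sub>i = 0\<close> almost everywhere on \<open>{F\<^sub>i = 0}\<close>, proportionality of the
  reversed hazard rates gives \<open>f\<^sub>i F\<^sub>0 = \<beta>\<^sub>i f\<^sub>0 F\<^sub>i\<close> almost everywhere, so this probability is
  \<open>\<beta>\<^sub>i P(Z \<in> A, \<delta> = 1)\<close>. Ties are null events; summing over \<open>i\<close> yields
  \<open>P(Z \<in> A) = (1 + \<Sum>\<beta>\<^sub>i) P(Z \<in> A, \<delta> = 1)\<close>, and \<open>A = UNIV\<close> identifies the constant as \<open>1 / P(\<delta> = 1)\<close>.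
\<close>

context prob_space
begin

section \<open>Integrating out one of several independent variables\<close>

text \<open>Fubini on the product of the two laws, followed by a change of variables along
  \<open>h\<close>. Only \<open>h (V \<omega>)\<close> has a density: \<open>V\<close> itself will
  be a family indexed by a singleton, and \<open>h\<close> the evaluation at its index.\<close>

lemma emeasure_indep_var_pair:
  assumes ind: "indep_var K V L W" and h[measurable]: "h \<in> measurable K N"
    and X: "distributed M N (\<lambda>\<omega>. h (V \<omega>)) f"
    and P[measurable]: "Measurable.pred (N \<Otimes>\<^sub>M L) (\<lambda>z. P (fst z) (snd z))"
  shows "emeasure M {\<omega> \<in> space M. P (h (V \<omega>)) (W \<omega>)} =
    (\<integral>\<^sup>+t. f t * emeasure M {\<omega> \<in> space M. P t (W \<omega>)} \<partial>N)"
proof -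
  note rv[measurable] = indep_var_rv1[OF ind] indep_var_rv2[OF ind]
  note sp = measurable_space[OF h] measurable_space[OF rv(1)] measurable_space[OF rv(2)]
  have f[measurable]: "f \<in> borel_measurable N"
    using X by (rule distributed_borel_measurable)
  interpret W: prob_space "distr M L W"
    by (rule prob_space_distr) simp
  have [measurable]: "Measurable.pred (K \<Otimes>\<^sub>M L) (\<lambda>z. P (h (fst z)) (snd z))"
    using measurable_compose[of "\<lambda>z. (h (fst z), snd z)" "K \<Otimes>\<^sub>M L" "N \<Otimes>\<^sub>M L", OF _ P] by simp
  let ?S = "{z \<in> space (K \<Otimes>\<^sub>M L). P (h (fst z)) (snd z)}"
  have [measurable]: "?S \<in> sets (K \<Otimes>\<^sub>M L)"
    by measurable
  let ?p = "\<lambda>t. emeasure M {\<omega> \<in> space M. P t (W \<omega>)}"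
  have slice: "{w \<in> space L. P t w} \<in> sets L" if "t \<in> space N" for t
    using measurable_compose[OF measurable_Pair1'[OF that] P] by simp
  have p: "?p t = emeasure (distr M L W) {w \<in> space L. P t w}" if "t \<in> space N" for t
    using slice[OF that] sp by (auto simp: emeasure_distr intro!: arg_cong[where f="emeasure M"])
  \<comment> \<open>Section measures of a measurable set depend measurably on the base point; on
    \<open>space N\<close> they coincide with \<open>?p\<close>, and measurability looks no
    further.\<close>
  have "(\<lambda>t. emeasure (distr M L W) {w \<in> space (distr M L W). P t w}) \<in> borel_measurable N"
    by measurable
  then have [measurable]: "?p \<in> borel_measurable N"
    by (subst measurable_cong[OF p]) auto
  have "emeasure M {\<omega> \<in> space M. P (h (V \<omega>)) (W \<omega>)} =
      emeasure (distr M (K \<Otimes>\<^sub>M L) (\<lambda>\<omega>. (V \<omega>, W \<omega>))) ?S"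
    using sp by (subst emeasure_distr) (auto intro!: arg_cong[where f="emeasure M"] simp: space_pair_measure)
  also have "\<dots> = emeasure (distr M K V \<Otimes>\<^sub>M distr M L W) ?S"
    using ind by (simp add: indep_var_distribution_eq)
  also have "\<dots> = (\<integral>\<^sup>+v. emeasure (distr M L W) (Pair v -` ?S) \<partial>distr M K V)"
    by (rule W.emeasure_pair_measure_alt) simp
  also have "\<dots> = (\<integral>\<^sup>+v. ?p (h v) \<partial>distr M K V)"
    using sp by (intro nn_integral_cong)
      (auto simp: p space_pair_measure intro!: arg_cong[where f="emeasure (distr M L W)"])
  also have "\<dots> = (\<integral>\<^sup>+t. ?p t \<partial>distr M N (\<lambda>\<omega>. h (V \<omega>)))"
    by (simp add: nn_integral_distr)
  also have "\<dots> = (\<integral>\<^sup>+t. f t * ?p t \<partial>N)"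
    unfolding distributed_distr_eq_density[OF X] by (rule nn_integral_density) measurable
  finally show ?thesis .
qed

lemma emeasure_indep_vars_pair:
  assumes ind: "indep_vars (\<lambda>_. borel) (X :: 'i \<Rightarrow> 'a \<Rightarrow> real) I"
    and J: "i \<in> I" "J \<subseteq> I" "i \<notin> J" and X: "distributed M lborel (X i) f"
    and P: "Measurable.pred (lborel \<Otimes>\<^sub>M PiM J (\<lambda>_. borel)) (\<lambda>z. P (fst z) (snd z))"
  shows "emeasure M {\<omega> \<in> space M. P (X i \<omega>) (\<lambda>k\<in>J. X k \<omega>)} =
    (\<integral>\<^sup>+t. f t * emeasure M {\<omega> \<in> space M. P t (\<lambda>k\<in>J. X k \<omega>)} \<partial>lborel)"
proof -
  have "indep_var (PiM {i} (\<lambda>_. borel)) (\<lambda>\<omega>. \<lambda>k\<in>{i}. X k \<omega>) (PiM J (\<lambda>_. borel)) (\<lambda>\<omega>. \<lambda>k\<in>J. X k \<omega>)"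
    using J by (intro indep_var_restrict[OF ind]) auto
  moreover have "(\<lambda>x. x i) \<in> measurable (PiM {i} (\<lambda>_. borel :: real measure)) lborel"
    by measurable
  ultimately show ?thesis
    using emeasure_indep_var_pair[where h="\<lambda>x. x i" and V="\<lambda>\<omega>. \<lambda>k\<in>{i}. X k \<omega>" and N=lborel and f=f and P=P] X P
    by simp
qed

lemma dist_fun_eq_prob:
  assumes [measurable]: "random_variable borel X"
  shows "dist_fun M X t = prob {\<omega> \<in> space M. X \<omega> \<le> t}"
  by (auto simp: dist_fun_def cdf_def measure_distr intro!: arg_cong[where f=prob])

text \<open>Given \<open>X i = t\<close>, the variable with index \<open>i\<close> is the largest
  exactly when all others are at most \<open>t\<close>, and independence turns the probability of
  that into a product of distribution functions.\<close>

lemma emeasure_argmax: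
  assumes ind: "indep_vars (\<lambda>_. borel) (X :: 'i \<Rightarrow> 'a \<Rightarrow> real) I" and I: "finite I" "i \<in> I"
    and X: "distributed M lborel (X i) f" and A[measurable]: "A \<in> sets borel"
  shows "emeasure M {\<omega> \<in> space M. X i \<omega> \<in> A \<and> (\<forall>k\<in>I. X k \<omega> \<le> X i \<omega>)} =
    (\<integral>\<^sup>+t. f t * ennreal (\<Prod>k\<in>I - {i}. dist_fun M (X k) t) * indicator A t \<partial>lborel)"
proof -
  let ?J = "I - {i}"
  note [simp] = I(1)
  have rv[measurable]: "random_variable borel (X k)" if "k \<in> I" for k
    using ind that by (auto simp: indep_vars_def)
  have "emeasure M {\<omega> \<in> space M. X i \<omega> \<in> A \<and> (\<forall>k\<in>I. X k \<omega> \<le> X i \<omega>)} =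
    emeasure M {\<omega> \<in> space M. X i \<omega> \<in> A \<and> (\<forall>k\<in>?J. (\<lambda>k\<in>?J. X k \<omega>) k \<le> X i \<omega>)}"
    \<comment> \<open>The comparison of \<open>X i\<close> with itself is trivial, so the event
      involves the other variables only through their restriction to \<open>?J\<close>.\<close>
    by (intro arg_cong[where f="emeasure M"]) auto
  also have "\<dots> = (\<integral>\<^sup>+t. f t * emeasure M {\<omega> \<in> space M. t \<in> A \<and> (\<forall>k\<in>?J. (\<lambda>k\<in>?J. X k \<omega>) k \<le> t)} \<partial>lborel)"
  proof (rule emeasure_indep_vars_pair[OF ind \<open>i \<in> I\<close> _ _ X,
      where J="?J" and P="\<lambda>t w. t \<in> A \<and> (\<forall>k\<in>?J. w k \<le> t)"])
    have [measurable]: "(\<lambda>z. snd z k) \<in> borel_measurable (lborel \<Otimes>\<^sub>M PiM ?J (\<lambda>_. borel :: real measure))"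
      if "k \<in> ?J" for k
      using that by (intro measurable_compose[OF measurable_snd measurable_component_singleton])
    show "Measurable.pred (lborel \<Otimes>\<^sub>M PiM ?J (\<lambda>_. borel)) (\<lambda>z. fst z \<in> A \<and> (\<forall>k\<in>?J. snd z k \<le> fst z))"
      by (intro pred_intros_logic pred_intros_finite) (simp, measurable)
  qed auto
  also have "\<dots> = (\<integral>\<^sup>+t. f t * ennreal (\<Prod>k\<in>?J. dist_fun M (X k) t) * indicator A t \<partial>lborel)"
  proof (rule nn_integral_cong)
    fix t
    have "prob {\<omega> \<in> space M. \<forall>k\<in>?J. X k \<omega> \<le> t} = (\<Prod>k\<in>?J. dist_fun M (X k) t)"
    \<comment> \<open>The product rule for independent variables asks for a nonempty index set;
      moreover an empty intersection would be \<open>UNIV\<close> rather than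
      \<open>space M\<close>.\<close>
    proof (cases "?J = {}")
      case True
      then show ?thesis unfolding True by (simp add: prob_space)
    next
      case False
      have "prob (\<Inter>k\<in>?J. X k -` {..t} \<inter> space M) = (\<Prod>k\<in>?J. prob (X k -` {..t} \<inter> space M))"
        using False by (intro indep_varsD[OF ind]) auto
      also have "(\<Inter>k\<in>?J. X k -` {..t} \<inter> space M) = {\<omega> \<in> space M. \<forall>k\<in>?J. X k \<omega> \<le> t}"
        using False by auto
      also have "(\<Prod>k\<in>?J. prob (X k -` {..t} \<inter> space M)) = (\<Prod>k\<in>?J. dist_fun M (X k) t)"
        by (intro prod.cong refl) (auto simp: dist_fun_eq_prob intro!: arg_cong[where f=prob])
      finally show ?thesis .
    qed
    then have "emeasure M {\<omega> \<in> space M. \<forall>k\<in>?J. X k \<omega> \<le> t} = ennreal (\<Prod>k\<in>?J. dist_fun M (X k) t)"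
      by (simp add: emeasure_eq_measure)
    then show "f t * emeasure M {\<omega> \<in> space M. t \<in> A \<and> (\<forall>k\<in>?J. (\<lambda>k\<in>?J. X k \<omega>) k \<le> t)} =
      f t * ennreal (\<Prod>k\<in>?J. dist_fun M (X k) t) * indicator A t"
      by (cases "t \<in> A") (auto cong: conj_cong)
  qed
  finally show ?thesis .
qed

section \<open>Absence of atoms and of ties\<close>

lemma AE_distributed_lborel_neq:
  assumes X: "distributed M lborel X f"
  shows "AE \<omega> in M. X \<omega> \<noteq> (t :: real)"
proof -
  have X'[measurable]: "random_variable borel X"
    using distributed_measurable[OF X] by simp
  have "emeasure M (X -` {t} \<inter> space M) = emeasure (distr M lborel X) {t}"
    by (subst emeasure_distr) auto
  also have "\<dots> = 0"
    unfolding distributed_distr_eq_density[OF X]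
    using distributed_borel_measurable[OF X] AE_lborel_singleton[of t]
    by (subst emeasure_density) (auto simp: nn_integral_0_iff_AE elim!: eventually_mono)
  finally show ?thesis
    by (intro AE_I[where N="X -` {t} \<inter> space M"]) auto
qed

text \<open>Fixing \<open>X i = t\<close> leaves the event \<open>X k = t\<close>, which is null
  because \<open>X k\<close> has a density; integrating over \<open>t\<close> keeps it null.\<close>

lemma AE_indep_vars_neq:
  assumes ind: "indep_vars (\<lambda>_. borel) (X :: 'i \<Rightarrow> 'a \<Rightarrow> real) I"
    and ik: "i \<in> I" "k \<in> I" "i \<noteq> k"
    and X: "distributed M lborel (X i) f" "distributed M lborel (X k) f'"
  shows "AE \<omega> in M. X i \<omega> \<noteq> X k \<omega>"
proof -
  have rv[measurable]: "random_variable borel (X k)" if "k \<in> I" for k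
    using ind that by (auto simp: indep_vars_def)
  note [measurable] = rv[OF ik(1)] rv[OF ik(2)]
  have "emeasure M {\<omega> \<in> space M. X i \<omega> = (\<lambda>k\<in>{k}. X k \<omega>) k} =
      (\<integral>\<^sup>+t. f t * emeasure M {\<omega> \<in> space M. t = (\<lambda>k\<in>{k}. X k \<omega>) k} \<partial>lborel)"
  proof (rule emeasure_indep_vars_pair[OF ind ik(1) _ _ X(1), where J="{k}" and P="\<lambda>t w. t = w k"])
    have [measurable]: "(\<lambda>z. snd z k) \<in> borel_measurable (lborel \<Otimes>\<^sub>M PiM {k} (\<lambda>_. borel :: real measure))"
      by (intro measurable_compose[OF measurable_snd measurable_component_singleton]) simp
    show "Measurable.pred (lborel \<Otimes>\<^sub>M PiM {k} (\<lambda>_. borel :: real measure)) (\<lambda>z. fst z = snd z k)"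
      by measurable
  qed (use ik in auto)
  also have "\<dots> = (\<integral>\<^sup>+t. 0 \<partial>(lborel :: real measure))"
  proof (rule nn_integral_cong)
    fix t
    have "AE \<omega> in M. t \<noteq> X k \<omega>"
      using AE_distributed_lborel_neq[OF X(2), of t] by (auto elim!: eventually_mono)
    then have "emeasure M {\<omega> \<in> space M. t = X k \<omega>} = 0"
      by (subst (asm) AE_iff_measurable[OF _ refl]) auto
    then show "f t * emeasure M {\<omega> \<in> space M. t = (\<lambda>k\<in>{k}. X k \<omega>) k} = 0"
      by simp
  qed
  finally have "emeasure M {\<omega> \<in> space M. X i \<omega> = X k \<omega>} = 0"
    by simp
  then show ?thesis
    by (subst AE_iff_measurable[OF _ refl]) auto
qed

section \<open>From reversed hazard rates to densities\<close>

text \<open>Supplies what the hazard condition leaves open, namely the points where a distribution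
  function vanishes. If it vanishes at \<open>r\<close>, the density integrates to 0 over the
  half-line up to \<open>r\<close>. Rational \<open>r\<close> keep the union of exceptional sets
  countable.\<close>

lemma AE_density_eq_0_if_dist_fun_eq_0:
  assumes X: "distributed M lborel X (\<lambda>t. ennreal (f t))" and f: "\<And>t. 0 \<le> f t"
  shows "AE t in lborel. dist_fun M X t = 0 \<longrightarrow> f t = 0"
proof -
  have X'[measurable]: "random_variable borel X"
    using distributed_measurable[OF X] by simp
  have F: "dist_fun M X t = prob {\<omega> \<in> space M. X \<omega> \<le> t}" for t
    by (rule dist_fun_eq_prob) simp
  have mono: "dist_fun M X s \<le> dist_fun M X t" if "s \<le> t" for s t
    unfolding F using that by (intro finite_measure_mono) auto
  have f'[measurable]: "f \<in> borel_measurable lborel"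
    using X f by (intro distributed_real_measurable) auto
  have q: "AE t in lborel. t \<le> r \<longrightarrow> f t = 0" if "dist_fun M X r = 0" for r
  proof -
    have "(\<integral>\<^sup>+t. ennreal (f t) * indicator {..r} t \<partial>lborel) = emeasure (distr M lborel X) {..r}"
      unfolding distributed_distr_eq_density[OF X]
      by (subst emeasure_density) auto
    also have "\<dots> = emeasure M {\<omega> \<in> space M. X \<omega> \<le> r}"
      by (subst emeasure_distr) (auto intro!: arg_cong[where f="emeasure M"])
    also have "\<dots> = 0"
      using that by (simp add: F emeasure_eq_measure)
    finally have "AE t in lborel. ennreal (f t) * indicator {..r} t = 0"
      by (subst (asm) nn_integral_0_iff_AE) auto
    then show ?thesis
      using f by (auto elim!: eventually_mono simp: ennreal_eq_0_iff order_antisym)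
  qed
  let ?N = "{t. dist_fun M X t = 0}"
  have "AE t in lborel. \<forall>r\<in>\<rat>. dist_fun M X r = 0 \<longrightarrow> t \<le> r \<longrightarrow> f t = 0"
    using q by (intro AE_ball_countable' countable_rat) (auto intro: AE_impI)
  \<comment> \<open>A zero with no larger zero above it can only be the supremum, a single point and
    hence negligible.\<close>
  moreover have "AE t in lborel. t \<noteq> Sup ?N"
    by (rule AE_lborel_singleton)
  ultimately show ?thesis
  proof eventually_elim
    case (elim t)
    show ?case
    proof
      assume t: "dist_fun M X t = 0"
      \<comment> \<open>The set of zeros is an initial segment, so \<open>t\<close> is its largest element or lies below a rational zero.\<close>
      obtain s where s: "s \<in> ?N" "t < s"
        using elim(2) t cSup_eq_maximum[of t ?N] by (force simp: not_le)
      obtain r where r: "r \<in> \<rat>" "t < r" "r < s"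
        using Rats_dense_in_real[OF s(2)] by auto
      have "dist_fun M X r = 0"
        using mono[of r s] s r by (simp add: F order_antisym)
      then show "f t = 0"
        using elim(1) r by auto
    qed
  qed
qed

text \<open>Clearing denominators gives an identity that also survives where a rate is undefined: if
  either distribution function vanishes, so does the density belonging to it, and both sides are 0.
  Negative \<open>t\<close> fall under this case, since \<open>Y\<close> is almost surely
  nonnegative.\<close>

lemma AE_proportional_reversed_hazards:
  assumes Y: "nonneg_rv_with_density M Y f" and C: "nonneg_rv_with_density M C g"
    and haz: "proportional_reversed_hazards M b C g Y f"
  shows "AE t in lborel. g t * dist_fun M Y t = b * f t * dist_fun M C t"
proof -
  have [measurable]: "random_variable borel Y" "random_variable borel C"
    using Y C distributed_measurable[of M lborel] by (auto simp: nonneg_rv_with_density_def)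
  have neg: "dist_fun M Y t = 0" if "t < 0" for t
  proof -
    have "AE \<omega> in M. \<not> Y \<omega> \<le> t"
      using Y that by (auto simp: nonneg_rv_with_density_def elim!: eventually_mono)
    then show ?thesis
      by (subst dist_fun_eq_prob) (auto simp: prob_eq_0)
  qed
  have nn: "0 \<le> dist_fun M Y t" "0 \<le> dist_fun M C t" for t
    by (simp_all add: dist_fun_eq_prob)
  have "AE t in lborel. dist_fun M Y t = 0 \<longrightarrow> f t = 0"
    using Y by (intro AE_density_eq_0_if_dist_fun_eq_0) (auto simp: nonneg_rv_with_density_def)
  moreover have "AE t in lborel. dist_fun M C t = 0 \<longrightarrow> g t = 0"
    using C by (intro AE_density_eq_0_if_dist_fun_eq_0) (auto simp: nonneg_rv_with_density_def)
  ultimately show ?thesis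
    using haz[unfolded proportional_reversed_hazards_def]
  proof eventually_elim
    case (elim t)
    show ?case
    proof (cases "dist_fun M Y t = 0 \<or> dist_fun M C t = 0")
      case True
      then show ?thesis using elim by auto
    next
      case False
      then have "0 < dist_fun M Y t" "0 < dist_fun M C t" "0 \<le> t"
        using nn[of t] neg[of t] by linarith+
      then show ?thesis
        using elim(3) by (simp add: reversed_hazard_rate_def field_simps)
    qed
  qed
qed

section \<open>Which variable attains the maximum\<close>

lemma emeasure_argmax_proportional:
  assumes ind: "indep_vars (\<lambda>_. borel) (X :: 'i \<Rightarrow> 'a \<Rightarrow> real) I" and I: "finite I" "i \<in> I" "j \<in> I"
    and X: "nonneg_rv_with_density M (X i) f" "nonneg_rv_with_density M (X j) g"
    and haz: "i \<noteq> j \<Longrightarrow> proportional_reversed_hazards M b (X j) g (X i) f"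
    and b: "0 \<le> b" "i = j \<Longrightarrow> b = 1" and A[measurable]: "A \<in> sets borel"
  shows "emeasure M {\<omega> \<in> space M. X j \<omega> \<in> A \<and> (\<forall>k\<in>I. X k \<omega> \<le> X j \<omega>)} =
    ennreal b * emeasure M {\<omega> \<in> space M. X i \<omega> \<in> A \<and> (\<forall>k\<in>I. X k \<omega> \<le> X i \<omega>)}"
proof (cases "i = j")
  case True
  then show ?thesis using b by simp
next
  case False
  let ?F = "\<lambda>k. dist_fun M (X k)"
  have D: "distributed M lborel (X i) (\<lambda>t. ennreal (f t))" "distributed M lborel (X j) (\<lambda>t. ennreal (g t))"
    and nn: "\<And>t. 0 \<le> f t" "\<And>t. 0 \<le> g t"
    using X by (auto simp: nonneg_rv_with_density_def)
  have [measurable]: "f \<in> borel_measurable lborel"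
    using D nn by (intro distributed_real_measurable) auto
  have rv: "random_variable borel (X k)" if "k \<in> I" for k
    using ind that by (auto simp: indep_vars_def)
  have F_meas[measurable]: "?F k \<in> borel_measurable borel" if "k \<in> I" for k
    using rv[OF that]
    by (intro borel_measurable_mono monoI) (auto simp: dist_fun_eq_prob intro!: finite_measure_mono)
  have "AE t in lborel. g t * (\<Prod>k\<in>I - {j}. ?F k t) = b * (f t * (\<Prod>k\<in>I - {i}. ?F k t))"
    using AE_proportional_reversed_hazards[OF X haz[OF False]]
  proof eventually_elim
    case (elim t)
    have "(\<Prod>k\<in>I - {j}. ?F k t) = ?F i t * (\<Prod>k\<in>I - {i, j}. ?F k t)"
      using I False by (subst prod.remove[of _ i]) (auto intro!: arg_cong2[where f="(*)"] prod.cong)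
    moreover have "(\<Prod>k\<in>I - {i}. ?F k t) = ?F j t * (\<Prod>k\<in>I - {i, j}. ?F k t)"
      using I False by (subst prod.remove[of _ j]) (auto intro!: arg_cong2[where f="(*)"] prod.cong)
    ultimately show ?case
      using elim by (simp add: algebra_simps)
  qed
  then have ae: "AE t in lborel. ennreal (g t) * ennreal (\<Prod>k\<in>I - {j}. ?F k t) * indicator A t =
    ennreal b * (ennreal (f t) * ennreal (\<Prod>k\<in>I - {i}. ?F k t) * indicator A t)"
  proof eventually_elim
    case (elim t)
    then have "ennreal (g t * (\<Prod>k\<in>I - {j}. ?F k t)) = ennreal (b * (f t * (\<Prod>k\<in>I - {i}. ?F k t)))"
      by simp
    then show ?case
      \<comment> \<open>\<open>ennreal_mult'\<close> requires a sign only for the first factor, so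
        nonnegativity of \<open>b\<close>, \<open>f t\<close> and \<open>g t\<close> suffices to
        split the products.\<close>
      using b(1) nn by (simp add: ennreal_mult' mult.assoc[symmetric] del: mult_cancel_left)
  qed
  have "emeasure M {\<omega> \<in> space M. X j \<omega> \<in> A \<and> (\<forall>k\<in>I. X k \<omega> \<le> X j \<omega>)} =
    (\<integral>\<^sup>+t. ennreal (g t) * ennreal (\<Prod>k\<in>I - {j}. ?F k t) * indicator A t \<partial>lborel)"
    by (rule emeasure_argmax[OF ind I(1,3) D(2) A])
  also have "\<dots> = (\<integral>\<^sup>+t. ennreal b * (ennreal (f t) * ennreal (\<Prod>k\<in>I - {i}. ?F k t) * indicator A t) \<partial>lborel)"
    by (rule nn_integral_cong_AE[OF ae])
  also have "\<dots> = ennreal b * (\<integral>\<^sup>+t. ennreal (f t) * ennreal (\<Prod>k\<in>I - {i}. ?F k t) * indicator A t \<partial>lborel)"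
    by (rule nn_integral_cmult) measurable
  also have "\<dots> = ennreal b * emeasure M {\<omega> \<in> space M. X i \<omega> \<in> A \<and> (\<forall>k\<in>I. X k \<omega> \<le> X i \<omega>)}"
    by (simp only: emeasure_argmax[OF ind I(1,2) D(1) A])
  finally show ?thesis .
qed

text \<open>Outside the null set of ties exactly one index attains the maximum, so the indicators of
  the events \<open>?E i\<close> add up to the indicator of the whole event. Integrating this
  identity gives the sum.\<close>

lemma emeasure_Max_eq_sum_argmax:
  assumes ind: "indep_vars (\<lambda>_. borel) (X :: 'i \<Rightarrow> 'a \<Rightarrow> real) I" and I: "finite I" "I \<noteq> {}"
    and X: "\<And>i. i \<in> I \<Longrightarrow> distributed M lborel (X i) (f i)" and A[measurable]: "A \<in> sets borel"
  shows "emeasure M {\<omega> \<in> space M. Max ((\<lambda>i. X i \<omega>) ` I) \<in> A} =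
    (\<Sum>i\<in>I. emeasure M {\<omega> \<in> space M. X i \<omega> \<in> A \<and> (\<forall>k\<in>I. X k \<omega> \<le> X i \<omega>)})"
proof -
  let ?Z = "\<lambda>\<omega>. Max ((\<lambda>i. X i \<omega>) ` I)"
  let ?E = "\<lambda>i. {\<omega> \<in> space M. X i \<omega> \<in> A \<and> (\<forall>k\<in>I. X k \<omega> \<le> X i \<omega>)}"
  note [simp] = I(1)
  have rv[measurable]: "random_variable borel (X k)" if "k \<in> I" for k
    using ind that by (auto simp: indep_vars_def)
  have [measurable]: "random_variable borel ?Z"
    by measurable
  have E[measurable]: "?E i \<in> events" if [measurable]: "i \<in> I" for i
    by measurable
  have "AE \<omega> in M. \<forall>i\<in>I. \<forall>k\<in>I. i \<noteq> k \<longrightarrow> X i \<omega> \<noteq> X k \<omega>"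
    using X by (intro AE_finite_allI I) (auto intro: AE_impI AE_indep_vars_neq[OF ind])
  then have ae: "AE \<omega> in M. indicator {\<omega> \<in> space M. ?Z \<omega> \<in> A} \<omega> = (\<Sum>i\<in>I. indicator (?E i) \<omega> :: ennreal)"
    using AE_space
  proof eventually_elim
    case (elim \<omega>)
    have "?Z \<omega> \<in> (\<lambda>i. X i \<omega>) ` I"
      using I by (intro Max_in) auto
    then obtain i where i: "i \<in> I" "?Z \<omega> = X i \<omega>"
      by auto
    have le: "X k \<omega> \<le> X i \<omega>" if "k \<in> I" for k
      using that I unfolding i(2)[symmetric] by (intro Max_ge) auto
    have "indicator (?E k) \<omega> = (0 :: ennreal)" if "k \<in> I - {i}" for k
      using that elim le[of k] i by (force simp: indicator_def)
    then have "(\<Sum>k\<in>I. indicator (?E k) \<omega> :: ennreal) = indicator (?E i) \<omega>"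
      using i by (subst sum.remove[of _ i]) auto
    also have "\<dots> = indicator {\<omega> \<in> space M. ?Z \<omega> \<in> A} \<omega>"
      using i le by (auto simp: indicator_def)
    finally show ?case ..
  qed
  have "emeasure M {\<omega> \<in> space M. ?Z \<omega> \<in> A} = (\<integral>\<^sup>+\<omega>. indicator {\<omega> \<in> space M. ?Z \<omega> \<in> A} \<omega> \<partial>M)"
    by (rule nn_integral_indicator[symmetric]) measurable
  also have "\<dots> = (\<integral>\<^sup>+\<omega>. (\<Sum>i\<in>I. indicator (?E i) \<omega>) \<partial>M)"
    by (rule nn_integral_cong_AE[OF ae])
  also have "\<dots> = (\<Sum>i\<in>I. \<integral>\<^sup>+\<omega>. indicator (?E i) \<omega> \<partial>M)"
    by (rule nn_integral_sum) (auto intro: borel_measurable_indicator E)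
  also have "\<dots> = (\<Sum>i\<in>I. emeasure M (?E i))"
    by (intro sum.cong refl nn_integral_indicator E)
  finally show ?thesis .
qed

section \<open>Independence from an indicator\<close>

text \<open>An indicator generates only the four events built from \<open>D\<close>. The product
  rule for \<open>D\<close> passes to its complement by subtraction and is trivial for the empty
  event and for \<open>space M\<close>.\<close>

lemma indep_var_indicator:
  fixes Z :: "'a \<Rightarrow> real"
  assumes Z[measurable]: "random_variable borel Z" and D[measurable]: "{\<omega> \<in> space M. \<omega> \<in> D} \<in> events"
    and eq: "\<And>A. A \<in> sets borel \<Longrightarrow> prob {\<omega> \<in> space M. Z \<omega> \<in> A \<and> \<omega> \<in> D} =
      prob {\<omega> \<in> space M. Z \<omega> \<in> A} * prob {\<omega> \<in> space M. \<omega> \<in> D}"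
  shows "indep_var borel Z borel (indicator D :: 'a \<Rightarrow> real)"
proof -
  let ?D = "{\<omega> \<in> space M. \<omega> \<in> D}"
  let ?d = "indicator D :: 'a \<Rightarrow> real"
  have d[measurable]: "random_variable borel ?d"
    using D by (subst borel_measurable_indicator_iff) (simp add: Int_def conj_commute)
  \<comment> \<open>Preimages of Borel sets already form a sigma-algebra, so independence can be
    tested on the preimages themselves.\<close>
  have gen: "sigma_sets (space M) {T -` A \<inter> space M | A. A \<in> sets borel} = {T -` A \<inter> space M | A. A \<in> sets borel}"
    if "random_variable borel T" for T :: "'a \<Rightarrow> real"
    using sets_vimage_algebra[of "space M" T "borel :: real measure"]
      sets_vimage_algebra2[of T "space M" "borel :: real measure"] by simp
  show ?thesis
    unfolding indep_var_eq gen[OF Z] gen[OF d]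
  proof (intro conjI Z d indep_setI; clarify?)
    fix A B :: "real set"
    assume A[measurable]: "A \<in> sets borel" and B: "B \<in> sets borel"
    let ?a = "{\<omega> \<in> space M. Z \<omega> \<in> A}"
    have a: "Z -` A \<inter> space M = ?a" by auto
    have eqA: "prob (?a \<inter> ?D) = prob ?a * prob ?D"
      using eq[OF A] by (simp add: Int_def conj_ac)
    have [measurable]: "?a \<in> events" by measurable
    have "?a \<inter> (space M - ?D) = ?a - ?a \<inter> ?D" by auto
    then have eqA': "prob (?a \<inter> (space M - ?D)) = prob ?a * prob (space M - ?D)"
      using eqA by (simp add: finite_measure_Diff prob_compl prob_space algebra_simps)
    have vB: "?d -` B \<inter> space M = (if 1 \<in> B then ?D else {}) \<union> (if 0 \<in> B then space M - ?D else {})"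
      by (auto simp: indicator_def of_bool_def split: if_splits)
    have full: "?D \<union> (space M - ?D) = space M" "?a \<inter> space M = ?a"
      by auto
    show "prob ((Z -` A \<inter> space M) \<inter> (?d -` B \<inter> space M)) = prob (Z -` A \<inter> space M) * prob (?d -` B \<inter> space M)"
      unfolding a vB
      by (cases "1 \<in> B"; cases "0 \<in> B")
         (simp_all only: if_True if_False Un_empty_left Un_empty_right Int_empty_right full eqA eqA'
           prob_space measure_empty mult_zero_right mult_1_right)
  qed (auto intro: measurable_sets)
qed

end

section \<open>Independence of the maximum and its indicator\<close>

theorem theorem3:
  fixes M :: "'a measure" and m :: nat
    and Y :: "'a \<Rightarrow> real" and C :: "nat \<Rightarrow> 'a \<Rightarrow> real"
    and f :: "real \<Rightarrow> real" and g :: "nat \<Rightarrow> real \<Rightarrow> real"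
    and \<beta> :: "nat \<Rightarrow> real"
  assumes "prob_space M"
    and "m \<ge> 2"
    and "nonneg_rv_with_density M Y f"
    and "\<And>j. j \<in> {1..m - 1} \<Longrightarrow> nonneg_rv_with_density M (C j) (g j)"
    and "prob_space.indep_vars M (\<lambda>_. borel) (\<lambda>i. if i = 0 then Y else C i) {0..m - 1}"
    and "\<And>j. j \<in> {1..m - 1} \<Longrightarrow> \<beta> j > 0"
    and "\<And>j. j \<in> {1..m - 1} \<Longrightarrow> proportional_reversed_hazards M (\<beta> j) (C j) (g j) Y f"
  shows "prob_space.indep_var M borel (observed_max m Y C) borel (max_indicator m Y C)"
proof -
  interpret prob_space M by fact
  let ?I = "{0..m - 1}"
  define X where "X i = (if i = 0 then Y else C i)" for i
  define d where "d i = (if i = 0 then f else g i)" for i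
  \<comment> \<open>The value 1 at index 0 compares \<open>Y\<close> with itself and produces the
    summand 1 in the total weight \<open>?s\<close>.\<close>
  define b where "b i = (if i = 0 then 1 else \<beta> i)" for i
  let ?E = "\<lambda>A i. {\<omega> \<in> space M. X i \<omega> \<in> A \<and> (\<forall>k\<in>?I. X k \<omega> \<le> X i \<omega>)}"
  let ?D = "{\<omega>. \<forall>j\<in>{1..m - 1}. C j \<omega> \<le> Y \<omega>}"
  let ?Z = "observed_max m Y C"
  have I: "?I = insert 0 {1..m - 1}" by auto
  have ind: "indep_vars (\<lambda>_. borel) X ?I"
    using assms(5) unfolding X_def .
  have X: "nonneg_rv_with_density M (X i) (d i)" if "i \<in> ?I" for i
    using assms(3) assms(4)[of i] that by (auto simp: X_def d_def)
  have b: "0 < b i" if "i \<in> ?I" for i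
    using assms(6)[of i] that by (auto simp: b_def)
  have rv[measurable]: "random_variable borel (X i)" if "i \<in> ?I" for i
    using ind that by (auto simp: indep_vars_def)
  have Z: "?Z = (\<lambda>\<omega>. Max ((\<lambda>i. X i \<omega>) ` ?I))"
    unfolding observed_max_def I image_insert by (auto simp: X_def fun_eq_iff intro!: arg_cong[where f=Max])
  have [measurable]: "random_variable borel ?Z"
    unfolding Z by measurable
  have D: "\<omega> \<in> ?D \<longleftrightarrow> (\<forall>k\<in>?I. X k \<omega> \<le> X 0 \<omega>)" for \<omega>
    unfolding I by (auto simp: X_def)
  \<comment> \<open>On \<open>?D\<close> the maximum is \<open>Y\<close> itself, so the joint event
    is the argmax event of index 0.\<close>
  have ZD: "{\<omega> \<in> space M. ?Z \<omega> \<in> A \<and> \<omega> \<in> ?D} = ?E A 0" for A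
  proof -
    have "?Z \<omega> = X 0 \<omega>" if "\<forall>k\<in>?I. X k \<omega> \<le> X 0 \<omega>" for \<omega>
      unfolding Z using that by (intro Max_eqI) auto
    then show ?thesis
      unfolding D by auto
  qed
  let ?s = "\<Sum>i\<in>?I. b i"
  have s: "0 < ?s"
    using b by (intro sum_pos) auto
  have key: "prob {\<omega> \<in> space M. ?Z \<omega> \<in> A} = ?s * prob {\<omega> \<in> space M. ?Z \<omega> \<in> A \<and> \<omega> \<in> ?D}"
    if A: "A \<in> sets borel" for A
  proof -
    have "emeasure M {\<omega> \<in> space M. ?Z \<omega> \<in> A} = (\<Sum>i\<in>?I. emeasure M (?E A i))"
      unfolding Z using X A
      by (intro emeasure_Max_eq_sum_argmax[OF ind, where f="\<lambda>i t. ennreal (d i t)"])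
         (auto simp: nonneg_rv_with_density_def)
    also have "\<dots> = (\<Sum>i\<in>?I. ennreal (b i) * emeasure M (?E A 0))"
    proof (intro sum.cong refl)
      fix j assume j: "j \<in> ?I"
      show "emeasure M (?E A j) = ennreal (b j) * emeasure M (?E A 0)"
        using assms(7)[of j] j X[OF j] X[of 0] b[OF j] A
        by (intro emeasure_argmax_proportional[OF ind, where f="d 0" and g="d j"])
           (auto simp: X_def b_def d_def)
    qed
    also have "\<dots> = ennreal (?s * prob (?E A 0))"
    proof -
      have "(\<Sum>i\<in>?I. ennreal (b i)) = ennreal ?s"
        using b by (intro sum_ennreal) (auto intro: less_imp_le)
      then show ?thesis
        using s by (simp only: sum_distrib_right[symmetric] emeasure_eq_measure) (simp add: ennreal_mult')
    qed
    finally have "prob {\<omega> \<in> space M. ?Z \<omega> \<in> A} = ?s * prob (?E A 0)"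
      using s by (simp add: emeasure_eq_measure)
    then show ?thesis
      unfolding ZD .
  qed
  have "indep_var borel ?Z borel (indicator ?D :: 'a \<Rightarrow> real)"
  proof (rule indep_var_indicator)
    show "{\<omega> \<in> space M. \<omega> \<in> ?D} \<in> events"
      unfolding D by measurable
    \<comment> \<open>Taking \<open>A = UNIV\<close> in \<open>key\<close> makes \<open>?s\<close>
      the reciprocal of the probability of \<open>?D\<close>; multiplying \<open>key\<close> for
      general \<open>A\<close> by that probability then cancels \<open>?s\<close>.\<close>
    have "?s * prob {\<omega> \<in> space M. \<omega> \<in> ?D} = 1"
      using key[of UNIV] by (simp add: prob_space)
    then show "prob {\<omega> \<in> space M. ?Z \<omega> \<in> A \<and> \<omega> \<in> ?D} =
        prob {\<omega> \<in> space M. ?Z \<omega> \<in> A} * prob {\<omega> \<in> space M. \<omega> \<in> ?D}" if "A \<in> sets borel" for A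
      using key[OF that] by (simp add: ac_simps)
  qed measurable
  then show ?thesis
    unfolding max_indicator_def .
qed

end
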